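(* Let $\mathcal{A}$ be a ternary Jordan algebra over a field $\mathrm{F}$, let $U$ be a subspace of $\mathcal{A}$ with $\mathcal{A}=U\oplus[\![\mathcal{A},\mathcal{A},\mathcal{A}]\!]$ (vector space direct sum), and let $\tilde{\mathcal{A}}$ be the ternary Jordan algebra and $l_u:QDer(\mathcal{A})\to\mathrm{End}(\tilde{\mathcal{A}})$ the map associated with $\mathcal{A}$ and $U$ as defined in the context. Then: (1) $l_u$ is injective and does not depend on the choice of $f'$; (2) $l_u(QDer(\mathcal{A}))\subseteq Der(\tilde{\mathcal{A}})$.
   Context: A ternary Jordan algebra over a field $\mathrm{F}$ is an $\mathrm{F}$-vector space $\mathcal{A}$ with a trilinear map $[\![\cdot,\cdot,\cdot]\!]:\mathcal{A}^3\to\mathcal{A}$ that is invariant under all permutations of its arguments and such that for all $x_2,x_3,y_2,y_3\in\mathcal{A}$ the commutator $[R_{(x_2,x_3)},R_{(y_2,y_3)}]$ is a derivation of $\mathcal{A}$, where $R_{(y_2,y_3)}(y)=[\![y,y_2,y_3]\!]$. A derivation is a linear map $D$ with $D([\![x,y,z]\!])=[\![D(x),y,z]\!]+[\![x,D(y),z]\!]+[\![x,y,D(z)]\!]$ for all $x,y,z$; $Der(\cdot)$ is the set of derivations. $[\![\mathcal{A},\mathcal{A},\mathcal{A}]\!]$ denotes the linear span of all products. $QDer(\mathcal{A})$ (quasiderivations) is the set of linear maps $f:\mathcal{A}\to\mathcal{A}$ for which there is a linear map $f':\mathcal{A}\to\mathcal{A}$ with $[\![f(x),y,z]\!]+[\![x,f(y),z]\!]+[\![x,y,f(z)]\!]=f'([\![x,y,z]\!])$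 for all $x,y,z$. Let $t$ be an indeterminate and write $t^i$ also for its class in $\mathrm{F}[t]/\langle t^4\rangle$. $\tilde{\mathcal{A}}$ is the subspace $\mathcal{A}t+\mathcal{A}t^2+\mathcal{A}t^3$ of $\mathcal{A}\otimes(\mathrm{F}[t]/\langle t^4\rangle)$, where $xt^i:=x\otimes t^i$, with trilinear product $[\![xt^i,yt^j,zt^k]\!]=[\![x,y,z]\!]t^{i+j+k}$ for $i,j,k\in\{1,2,3\}$ (so it equals $[\![x,y,z]\!]t^3$ if $i=j=k=1$ and $0$ otherwise). It is a ternary Jordan algebra, and $\tilde{\mathcal{A}}=\mathcal{A}t+\mathcal{A}t^2+[\![\mathcal{A},\mathcal{A},\mathcal{A}]\!]t^3+Ut^3$. The map $l_u:QDer(\mathcal{A})\to\mathrm{End}(\tilde{\mathcal{A}})$ is defined by $l_u(f)(at+bt^2+ct^3+ut^3)=f(a)t+f'(c)t^3$ for $a,b\in\mathcal{A}$, $c\in[\![\mathcal{A},\mathcal{A},\mathcal{A}]\!]$, $u\in U$, where $f'$ is any linear map satisfying the defining identity of the quasiderivation $f$. *)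

theory Defs
  imports Complex_Main "HOL-Library.Product_Plus"
begin

definition is_derivation ::
  "('k::field \<Rightarrow> 'a::ab_group_add \<Rightarrow> 'a) \<Rightarrow> ('a \<Rightarrow> 'a \<Rightarrow> 'a \<Rightarrow> 'a) \<Rightarrow> ('a \<Rightarrow> 'a) \<Rightarrow> bool"
  where "is_derivation scale br D \<longleftrightarrow>
    Vector_Spaces.linear scale scale D \<and>
    (\<forall>x y z. D (br x y z) = br (D x) y z + br x (D y) z + br x y (D z))"

definition Der ::
  "('k::field \<Rightarrow> 'a::ab_group_add \<Rightarrow> 'a) \<Rightarrow> ('a \<Rightarrow> 'a \<Rightarrow> 'a \<Rightarrow> 'a) \<Rightarrow> ('a \<Rightarrow> 'a) set"
  where "Der scale br = {D. is_derivation scale br D}"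

locale ternary_jordan_algebra = vector_space scale
  for scale :: "'k::field \<Rightarrow> 'a::ab_group_add \<Rightarrow> 'a" +
  fixes br :: "'a \<Rightarrow> 'a \<Rightarrow> 'a \<Rightarrow> 'a"
  assumes linear_1: "Vector_Spaces.linear scale scale (\<lambda>x. br x y z)"
    and linear_2: "Vector_Spaces.linear scale scale (\<lambda>y. br x y z)"
    and linear_3: "Vector_Spaces.linear scale scale (\<lambda>z. br x y z)"
    and perm_213: "br y x z = br x y z"
    and perm_132: "br x z y = br x y z"
    and perm_321: "br z y x = br x y z"
    and perm_231: "br y z x = br x y z"
    and perm_312: "br z x y = br x y z"
    and commutator_derivation:
      "is_derivation scale br (\<lambda>y. br (br y y2 y3) x2 x3 - br (br y x2 x3) y2 y3)"

text \<open>The linear span of all products.\<close>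

definition product_span ::
  "('k::field \<Rightarrow> 'a::ab_group_add \<Rightarrow> 'a) \<Rightarrow> ('a \<Rightarrow> 'a \<Rightarrow> 'a \<Rightarrow> 'a) \<Rightarrow> 'a set"
  where "product_span scale br = module.span scale {br x y z | x y z. True}"

text \<open>\<open>quasi_pair scale br f f'\<close>: the linear map \<open>f'\<close> witnesses that the linear map \<open>f\<close> is a
  quasiderivation.\<close>

definition quasi_pair ::
  "('k::field \<Rightarrow> 'a::ab_group_add \<Rightarrow> 'a) \<Rightarrow> ('a \<Rightarrow> 'a \<Rightarrow> 'a \<Rightarrow> 'a) \<Rightarrow>
    ('a \<Rightarrow> 'a) \<Rightarrow> ('a \<Rightarrow> 'a) \<Rightarrow> bool"
  where "quasi_pair scale br f f' \<longleftrightarrow>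
    Vector_Spaces.linear scale scale f \<and> Vector_Spaces.linear scale scale f' \<and>
    (\<forall>x y z. br (f x) y z + br x (f y) z + br x y (f z) = f' (br x y z))"

definition QDer ::
  "('k::field \<Rightarrow> 'a::ab_group_add \<Rightarrow> 'a) \<Rightarrow> ('a \<Rightarrow> 'a \<Rightarrow> 'a \<Rightarrow> 'a) \<Rightarrow> ('a \<Rightarrow> 'a) set"
  where "QDer scale br = {f. \<exists>f'. quasi_pair scale br f f'}"

text \<open>Since \<open>1, t, t\<^sup>2, t\<^sup>3\<close> is a basis of \<open>F[t]/(t\<^sup>4)\<close>, every element of the subspace
  \<open>At + At\<^sup>2 + At\<^sup>3\<close> of \<open>A \<otimes> F[t]/(t\<^sup>4)\<close> is \<open>at + bt\<^sup>2 + ct\<^sup>3\<close> for unique \<open>a, b, c\<close> in \<open>A\<close>.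
  It is represented by the triple \<open>(a, b, c)\<close>, with the componentwise vector space structure.\<close>

type_synonym 'a tilde = "'a \<times> 'a \<times> 'a"

definition tilde_scale :: "('k \<Rightarrow> 'a \<Rightarrow> 'a) \<Rightarrow> 'k \<Rightarrow> 'a tilde \<Rightarrow> 'a tilde"
  where "tilde_scale scale r = (\<lambda>(a, b, c). (scale r a, scale r b, scale r c))"

text \<open>\<open>mon x i\<close> is \<open>xt\<^sup>i\<close>, for \<open>i \<ge> 1\<close>; it vanishes for \<open>i \<ge> 4\<close>. The exponent \<open>0\<close> does not
  occur (the value there is a dummy).\<close>

definition mon :: "'a::zero \<Rightarrow> nat \<Rightarrow> 'a tilde"
  where "mon x i =
    (if i = 1 then (x, 0, 0) else if i = 2 then (0, x, 0) else if i = 3 then (0, 0, x) else 0)"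

text \<open>The coefficient of \<open>t\<^sup>i\<close>, for \<open>i \<in> {1, 2, 3}\<close>.\<close>

definition tcoeff :: "'a::zero tilde \<Rightarrow> nat \<Rightarrow> 'a"
  where "tcoeff p i =
    (if i = 1 then fst p else if i = 2 then fst (snd p) else if i = 3 then snd (snd p) else 0)"

text \<open>The trilinear extension of \<open>[xt\<^sup>i, yt\<^sup>j, zt\<^sup>k] = [x, y, z]t\<^bsup>i+j+k\<^esup>\<close>.\<close>

definition tilde_br ::
  "('a::ab_group_add \<Rightarrow> 'a \<Rightarrow> 'a \<Rightarrow> 'a) \<Rightarrow> 'a tilde \<Rightarrow> 'a tilde \<Rightarrow> 'a tilde \<Rightarrow> 'a tilde"
  where "tilde_br br p q r =
    (\<Sum>i\<in>{1,2,3}. \<Sum>j\<in>{1,2,3}. \<Sum>k\<in>{1,2,3}.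
      mon (br (tcoeff p i) (tcoeff q j) (tcoeff r k)) (i + j + k))"

text \<open>For \<open>A = U \<oplus> [A, A, A]\<close>, the component of \<open>d\<close> in \<open>[A, A, A]\<close>.\<close>

definition product_part ::
  "('k::field \<Rightarrow> 'a::ab_group_add \<Rightarrow> 'a) \<Rightarrow> ('a \<Rightarrow> 'a \<Rightarrow> 'a \<Rightarrow> 'a) \<Rightarrow> 'a set \<Rightarrow> 'a \<Rightarrow> 'a"
  where "product_part scale br U d =
    (THE c. c \<in> product_span scale br \<and> (\<exists>u\<in>U. d = c + u))"

text \<open>\<open>l_u_via scale br U f f'\<close> is the map \<open>at + bt\<^sup>2 + ct\<^sup>3 + ut\<^sup>3 \<mapsto> f(a)t + f'(c)t\<^sup>3\<close> built from
  a particular \<open>f'\<close> (see \<open>l_u_via_eq\<close> below), and \<open>l_u\<close> picks some \<open>f'\<close> belonging to \<open>f\<close>.\<close>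

definition l_u_via ::
  "('k::field \<Rightarrow> 'a::ab_group_add \<Rightarrow> 'a) \<Rightarrow> ('a \<Rightarrow> 'a \<Rightarrow> 'a \<Rightarrow> 'a) \<Rightarrow> 'a set \<Rightarrow>
    ('a \<Rightarrow> 'a) \<Rightarrow> ('a \<Rightarrow> 'a) \<Rightarrow> 'a tilde \<Rightarrow> 'a tilde"
  where "l_u_via scale br U f f' =
    (\<lambda>(a, b, d). mon (f a) 1 + mon (f' (product_part scale br U d)) 3)"

definition l_u ::
  "('k::field \<Rightarrow> 'a::ab_group_add \<Rightarrow> 'a) \<Rightarrow> ('a \<Rightarrow> 'a \<Rightarrow> 'a \<Rightarrow> 'a) \<Rightarrow> 'a set \<Rightarrow>
    ('a \<Rightarrow> 'a) \<Rightarrow> 'a tilde \<Rightarrow> 'a tilde"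
  where "l_u scale br U f = l_u_via scale br U f (SOME f'. quasi_pair scale br f f')"

definition direct_sum_UNIV ::
  "('k::field \<Rightarrow> 'a::ab_group_add \<Rightarrow> 'a) \<Rightarrow> 'a set \<Rightarrow> 'a set \<Rightarrow> bool"
  where "direct_sum_UNIV scale U W \<longleftrightarrow>
    module.subspace scale U \<and> module.subspace scale W \<and>
    U \<inter> W = {0} \<and> {u + w | u w. u \<in> U \<and> w \<in> W} = UNIV"

lemma tilde_eq_sum_mon: "(a, b, c) = mon a 1 + mon b 2 + mon (c::'a::ab_group_add) 3"
  by (simp add: mon_def)

context ternary_jordan_algebra
begin

lemma br_zero [simp]: "br 0 y z = 0" "br x 0 z = 0" "br x y 0 = 0"
  using linear_1 linear_2 linear_3 by (metis linear_iff_module_hom module_hom.zero)+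

lemma tilde_br_eq: "tilde_br br (a, b, c) (a', b', c') (a'', b'', c'') = (0, 0, br a a' a'')"
  by (simp add: tilde_br_def tcoeff_def mon_def zero_prod_def)

lemma tilde_br_mon:
  assumes "i \<in> {1,2,3}" "j \<in> {1,2,3}" "k \<in> {1,2,3}"
  shows "tilde_br br (mon x i) (mon y j) (mon z k) = mon (br x y z) (i + j + k)"
  using assms by (auto simp: mon_def tilde_br_eq zero_prod_def)

lemma vector_space_tilde: "vector_space (tilde_scale scale)"
  by unfold_locales
    (auto simp: tilde_scale_def scale_right_distrib scale_left_distrib)

lemma tilde_linearI:
  assumes "\<And>p q. F (p + q) = F p + F q" "\<And>r p. F (tilde_scale scale r p) = tilde_scale scale r (F p)"
  shows "Vector_Spaces.linear (tilde_scale scale) (tilde_scale scale) F"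
  using assms vector_space_tilde
  by (simp add: Vector_Spaces.linear_def module_hom_def module_hom_axioms_def
      module_iff_vector_space)

theorem tilde_ternary_jordan_algebra:
  "ternary_jordan_algebra (tilde_scale scale) (tilde_br br)"
proof -
  interpret t: vector_space "tilde_scale scale" by (rule vector_space_tilde)
  have add: "br (x + x') y z = br x y z + br x' y z" "br x (y + y') z = br x y z + br x y' z"
    "br x y (z + z') = br x y z + br x y z'" for x x' y y' z z'
    using linear_1[of y z, THEN linear_iff_module_hom[THEN iffD1], THEN module_hom.add]
      linear_2[of x z, THEN linear_iff_module_hom[THEN iffD1], THEN module_hom.add]
      linear_3[of x y, THEN linear_iff_module_hom[THEN iffD1], THEN module_hom.add]
    by blast+
  have sc: "br (scale r x) y z = scale r (br x y z)" "br x (scale r y) z = scale r (br x y z)"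
    "br x y (scale r z) = scale r (br x y z)" for r x y z
    using linear_1[of y z, THEN linear_iff_module_hom[THEN iffD1], THEN module_hom.scale]
      linear_2[of x z, THEN linear_iff_module_hom[THEN iffD1], THEN module_hom.scale]
      linear_3[of x y, THEN linear_iff_module_hom[THEN iffD1], THEN module_hom.scale]
    by blast+
  show ?thesis
    by unfold_locales
      (auto simp: tilde_scale_def tilde_br_eq add sc is_derivation_def zero_prod_def
        scale_right_distrib scale_left_distrib
        intro!: tilde_linearI intro: perm_213 perm_132 perm_321 perm_231 perm_312)
qed

lemma product_part_eq:
  assumes "direct_sum_UNIV scale U (product_span scale br)"
    and "c \<in> product_span scale br" "u \<in> U"
  shows "product_part scale br U (c + u) = c"
  unfolding product_part_def
proof (rule the_equality)
  fix c' assume c': "c' \<in> product_span scale br \<and> (\<exists>u'\<in>U. c + u = c' + u')"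
  then obtain u' where "u' \<in> U" and "c + u = c' + u'" by blast
  then have eq: "c - c' = u' - u"
    by (metis add.commute add_diff_cancel_left' diff_add_eq)
  then have "c - c' \<in> U \<inter> product_span scale br"
    using assms c' \<open>u' \<in> U\<close> unfolding direct_sum_UNIV_def by (metis IntI subspace_diff)
  then have "c - c' = 0" using assms(1) unfolding direct_sum_UNIV_def by blast
  then show "c' = c" by simp
qed (use assms in blast)

lemma l_u_via_eq:
  assumes "direct_sum_UNIV scale U (product_span scale br)"
    and "c \<in> product_span scale br" "u \<in> U"
  shows "l_u_via scale br U f f' (mon a 1 + mon b 2 + mon c 3 + mon u 3) =
    mon (f a) 1 + mon (f' c) 3"
  using product_part_eq[OF assms] by (simp add: l_u_via_def mon_def)

end

end

theory Submission
  imports Defs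
begin

context ternary_jordan_algebra
begin

text \<open>Under the direct sum hypothesis, \<open>product_part\<close> is the linear projection P
  onto the span of the products along \<open>U\<close>, and \<open>l_u_via\<close> is the map (a, b,
  d) \<mapsto> (f a, 0, f' (P d)). Two choices of f' agree on products, hence on their span, where P
  takes its values; so the map does not depend on f'. Its t-coefficient recovers f, which gives
  injectivity. A product of triples is (0, 0, \<open>br a a' a''\<close>) and P fixes it, so the
  derivation identity reduces to its t^3 coefficient, where it is the defining identity of a
  quasiderivation (\<open>l_u_via_in_Der\<close>).\<close>

lemma br_in_product_span: "br x y z \<in> product_span scale br"
  unfolding product_span_def by (rule span_base) blast

text \<open>A projection fixes its image. This lets f' act directly on products in the derivation
  identity.\<close>

lemma product_part_br:
  assumes "direct_sum_UNIV scale U (product_span scale br)"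
  shows "product_part scale br U (br x y z) = br x y z"
proof -
  \<comment> \<open>The decomposition of a product is the product itself plus 0.\<close>
  have "0 \<in> U"
    using assms by (simp add: direct_sum_UNIV_def subspace_0)
  from product_part_eq[OF assms br_in_product_span this] show ?thesis by simp
qed

lemma direct_sum_decompose:
  assumes "direct_sum_UNIV scale U W"
  obtains u w where "u \<in> U" "w \<in> W" "d = w + u"
proof -
  have "d \<in> {u + w | u w. u \<in> U \<and> w \<in> W}"
    using assms by (simp add: direct_sum_UNIV_def)
  then show ?thesis using that by (auto simp: add.commute)
qed

lemma product_part_in_product_span:
  assumes "direct_sum_UNIV scale U (product_span scale br)"
  shows "product_part scale br U d \<in> product_span scale br"
  by (metis assms direct_sum_decompose product_part_eq)

text \<open>Decompositions can be added and scaled termwise, and by uniqueness the results are the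
  decompositions of the sum and of the multiple.\<close>

lemma linear_product_part:
  assumes U: "direct_sum_UNIV scale U (product_span scale br)"
  shows "Vector_Spaces.linear scale scale (product_part scale br U)"
proof -
  let ?P = "product_part scale br U"
  have sub: "subspace U" "subspace (product_span scale br)"
    using U by (auto simp: direct_sum_UNIV_def)
  have "?P (d + e) = ?P d + ?P e" for d e
  proof -
    obtain u w where d: "u \<in> U" "w \<in> product_span scale br" "d = w + u"
      using direct_sum_decompose[OF U] .
    obtain v x where e: "v \<in> U" "x \<in> product_span scale br" "e = x + v"
      using direct_sum_decompose[OF U] .
    have "?P ((w + x) + (u + v)) = w + x"
      using U sub d e by (intro product_part_eq) (auto intro: subspace_add)
    moreover have "d + e = (w + x) + (u + v)" using d e by simp
    moreover have "?P d = w" "?P e = x" using d e product_part_eq[OF U] by auto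
    ultimately show ?thesis by (simp only:)
  qed
  moreover have "?P (scale r d) = scale r (?P d)" for r d
  proof -
    obtain u w where d: "u \<in> U" "w \<in> product_span scale br" "d = w + u"
      using direct_sum_decompose[OF U] .
    have "?P (scale r w + scale r u) = scale r w"
      using U sub d by (intro product_part_eq) (auto intro: subspace_scale)
    then show ?thesis using d product_part_eq[OF U] by (simp add: scale_right_distrib)
  qed
  ultimately show ?thesis
    by (intro linear_iff_module_hom[THEN iffD2]) (unfold_locales, auto)
qed

text \<open>The quasiderivation identity expresses the value at each product through f alone, and
  linear maps that agree on generators agree on the span.\<close>

lemma quasi_pair_unique_on_product_span:
  assumes "quasi_pair scale br f f\<^sub>1" "quasi_pair scale br f f\<^sub>2" "c \<in> product_span scale br"
  shows "f\<^sub>1 c = f\<^sub>2 c"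
proof -
  interpret vector_space_pair scale scale by unfold_locales
  show ?thesis
    using assms(3) unfolding product_span_def
    by (rule linear_eq_on[rotated 2]) (use assms(1,2) in \<open>auto simp: quasi_pair_def\<close>)
qed

text \<open>The witness is only ever evaluated at values of \<open>product_part\<close>, which lie
  in the span where any two witnesses agree.\<close>

lemma l_u_via_unique:
  assumes "direct_sum_UNIV scale U (product_span scale br)"
    and "quasi_pair scale br f f\<^sub>1" "quasi_pair scale br f f\<^sub>2"
  shows "l_u_via scale br U f f\<^sub>1 = l_u_via scale br U f f\<^sub>2"
  using quasi_pair_unique_on_product_span[OF assms(2,3) product_part_in_product_span[OF assms(1)]]
  by (simp add: l_u_via_def)

lemma l_u_via_triple:
  "l_u_via scale br U f f' (a, b, d) = (f a, 0, f' (product_part scale br U d))"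
  by (simp add: l_u_via_def mon_def)

lemma l_u_via_in_Der:
  assumes U: "direct_sum_UNIV scale U (product_span scale br)" and q: "quasi_pair scale br f f'"
  shows "l_u_via scale br U f f' \<in> Der (tilde_scale scale) (tilde_br br)"
proof -
  interpret P: module_hom scale scale "product_part scale br U"
    using linear_product_part[OF U] by (simp add: linear_iff_module_hom)
  interpret f: module_hom scale scale f
    using q by (simp add: quasi_pair_def linear_iff_module_hom)
  interpret f': module_hom scale scale f'
    using q by (simp add: quasi_pair_def linear_iff_module_hom)
  have "Vector_Spaces.linear (tilde_scale scale) (tilde_scale scale) (l_u_via scale br U f f')"
    by (rule tilde_linearI)
      (auto simp: tilde_scale_def l_u_via_triple P.add P.scale f.add f.scale f'.add f'.scale)
  moreover have "br (f x) y z + br x (f y) z + br x y (f z) = f' (br x y z)" for x y z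
    using q by (simp add: quasi_pair_def)
  \<comment> \<open>On a product, the t-coefficient of the image is f 0 = 0 and the t^3 coefficient
    is f' of the product in A, so only the quasiderivation identity remains.\<close>
  ultimately show ?thesis
    by (auto simp: Der_def is_derivation_def tilde_br_eq l_u_via_triple
        product_part_br[OF U] f.zero)
qed

text \<open>Evaluation at \<open>at\<close> has t-coefficient f a, whatever witness
  \<open>SOME\<close> selects.\<close>

lemma inj_l_u: "inj (l_u scale br U)"
proof (rule injI, rule ext)
  fix f g a
  assume "l_u scale br U f = l_u scale br U g"
  then have "l_u scale br U f (a, 0, 0) = l_u scale br U g (a, 0, 0)" by simp
  then show "f a = g a" by (simp add: l_u_def l_u_via_triple)
qed

end

theorem theorem5p2:
  fixes scale :: "'k::field \<Rightarrow> 'a::ab_group_add \<Rightarrow> 'a"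
    and br :: "'a \<Rightarrow> 'a \<Rightarrow> 'a \<Rightarrow> 'a"
    and U :: "'a set"
  assumes "ternary_jordan_algebra scale br"
    and "direct_sum_UNIV scale U (product_span scale br)"
  shows "(inj_on (l_u scale br U) (QDer scale br) \<and>
      (\<forall>f f\<^sub>1 f\<^sub>2. quasi_pair scale br f f\<^sub>1 \<and> quasi_pair scale br f f\<^sub>2 \<longrightarrow>
        l_u_via scale br U f f\<^sub>1 = l_u_via scale br U f f\<^sub>2)) \<and>
    l_u scale br U ` QDer scale br \<subseteq> Der (tilde_scale scale) (tilde_br br)"
proof (intro conjI allI impI)
  interpret ternary_jordan_algebra scale br by (rule assms(1))
  show "inj_on (l_u scale br U) (QDer scale br)"
    using inj_l_u by (rule inj_on_subset) simp
  show "l_u_via scale br U f f\<^sub>1 = l_u_via scale br U f f\<^sub>2"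
    if "quasi_pair scale br f f\<^sub>1 \<and> quasi_pair scale br f f\<^sub>2" for f f\<^sub>1 f\<^sub>2
    using l_u_via_unique[OF assms(2)] that by blast
  show "l_u scale br U ` QDer scale br \<subseteq> Der (tilde_scale scale) (tilde_br br)"
  proof (rule image_subsetI)
    fix f assume "f \<in> QDer scale br"
    \<comment> \<open>Membership in \<open>QDer\<close> guarantees that the map chosen inside
      \<open>l_u\<close> is a genuine witness.\<close>
    then have "quasi_pair scale br f (SOME f'. quasi_pair scale br f f')"
      unfolding QDer_def mem_Collect_eq by (rule someI_ex)
    then show "l_u scale br U f \<in> Der (tilde_scale scale) (tilde_br br)"
      unfolding l_u_def by (rule l_u_via_in_Der[OF assms(2)])
  qed
qed

end
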